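(* There does not exist a function $f:\mathbb{N}^4\to\mathbb{N}$ such that for all graphs $G,H$ the modular product $G\diamond H$ satisfies $$\mathrm{tww}(G\diamond H)\le f(\mathrm{tww}(G),\mathrm{tww}(H),\Delta(G),\Delta(H)).$$
   Context: All graphs are finite and simple (no loops or multiple edges). $\Delta(G)$ is the maximum degree of $G$, and $\mathbb{N}$ includes $0$. Twin-width. A trigraph $G$ has a vertex set $V(G)$, a set $E(G)$ of black edges and a set $R(G)$ of red edges, with $E(G)\cap R(G)=\emptyset$; a graph is a trigraph with no red edges. $N_G(v)$ is the set of vertices joined to $v$ by a black or red edge. A $d$-trigraph is a trigraph in which every vertex is incident with at most $d$ red edges. A contraction merges two distinct (not necessarily adjacent) vertices $u,v$ into a new vertex $w$: every vertex other than $u,v$ in $N_G(u)\triangle N_G(v)$ is joined to $w$ by a red edge; every $x\in N_G(u)\cap N_G(v)$ is joined to $w$ by a black edge if $ux,vx\in E(G)$ and by a red edge otherwise; all edges not incident with $u$ or $v$ are unchanged, and $u,v$ and their incident edges are removed. A $d$-sequence of an $n$-vertex graph $G$ is a sequence of $d$-trigraphs $G_n=G,G_{n-1},\dots,G_1=K_1$ with each $G_{i-1}$ obtained from $G_i$ by one contraction. The twin-width $\mathrm{tww}(G)$ is the least $d$ such that $G$ admits a $d$-sequence. Modular product. $G\diamond H$ has vertex set $V(G)\times V(H)$; $(u,i)(v,j)$ is an edge iff $u\ne v$, $i\ne j$, and either [$uv\in E(G)$ and $ij\in E(H)$] or [$uv\notin E(G)$ and $ij\notin E(H)$]. *)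

theory Defs
  imports Main
begin

text \<open>
  Edges are two-element sets of vertices. As in the literature on twin-width, a graph is a
  trigraph without red edges.
\<close>

record 'a trigraph =
  verts :: "'a set"
  black :: "'a set set"
  red :: "'a set set"

definition trigraph :: "'a trigraph \<Rightarrow> bool" where
  "trigraph G \<longleftrightarrow>
     finite (verts G) \<and>
     (\<forall>e \<in> black G \<union> red G. e \<subseteq> verts G \<and> card e = 2) \<and>
     black G \<inter> red G = {}"

text \<open>
  The empty graph is excluded: it has neither a contraction sequence ending in the one-vertex
  graph nor a maximum degree.
\<close>

definition graph :: "'a trigraph \<Rightarrow> bool" where
  "graph G \<longleftrightarrow> trigraph G \<and> red G = {} \<and> verts G \<noteq> {}"

definition nbrs :: "'a trigraph \<Rightarrow> 'a \<Rightarrow> 'a set" where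
  "nbrs G v = {x \<in> verts G. {v, x} \<in> black G \<union> red G}"

definition max_degree :: "'a trigraph \<Rightarrow> nat" where
  "max_degree G = Max ((\<lambda>v. card (nbrs G v)) ` verts G)"

definition d_trigraph :: "nat \<Rightarrow> 'a trigraph \<Rightarrow> bool" where
  "d_trigraph d G \<longleftrightarrow> trigraph G \<and> (\<forall>v \<in> verts G. card {e \<in> red G. v \<in> e} \<le> d)"

definition contract :: "'a trigraph \<Rightarrow> 'a \<Rightarrow> 'a \<Rightarrow> 'a \<Rightarrow> 'a trigraph" where
  "contract G u v w =
     \<lparr> verts = insert w (verts G - {u, v}),
       black = {e \<in> black G. u \<notin> e \<and> v \<notin> e}
         \<union> {{w, x} | x. x \<in> nbrs G u \<inter> nbrs G v \<and> {u, x} \<in> black G \<and> {v, x} \<in> black G},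
       red = {e \<in> red G. u \<notin> e \<and> v \<notin> e}
         \<union> {{w, x} | x. x \<in> (nbrs G u - nbrs G v) \<union> (nbrs G v - nbrs G u) \<and> x \<noteq> u \<and> x \<noteq> v}
         \<union> {{w, x} | x. x \<in> nbrs G u \<inter> nbrs G v \<and> \<not> ({u, x} \<in> black G \<and> {v, x} \<in> black G)} \<rparr>"

text \<open>
  The new vertex \<open>w\<close> only has to differ from the vertices that remain, so it may reuse the name
  \<open>u\<close> or \<open>v\<close>. The choice of \<open>w\<close> affects the result only up to isomorphism, and this way a
  contraction also exists when \<open>'a\<close> is finite and has no unused elements.
\<close>

definition contraction :: "'a trigraph \<Rightarrow> 'a trigraph \<Rightarrow> bool" where
  "contraction G G' \<longleftrightarrow>
     (\<exists>u \<in> verts G. \<exists>v \<in> verts G. \<exists>w. u \<noteq> v \<and> w \<notin> verts G - {u, v} \<and> G' = contract G u v w)"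

definition is_K1 :: "'a trigraph \<Rightarrow> bool" where
  "is_K1 G \<longleftrightarrow> (\<exists>v. G = \<lparr> verts = {v}, black = {}, red = {} \<rparr>)"

text \<open>\<open>S i\<close> is the trigraph \<open>G\<^sub>i\<close> on \<open>i\<close> vertices; values outside \<open>{1..n}\<close> are irrelevant.\<close>

definition d_sequence :: "nat \<Rightarrow> 'a trigraph \<Rightarrow> (nat \<Rightarrow> 'a trigraph) \<Rightarrow> bool" where
  "d_sequence d G S \<longleftrightarrow>
     (let n = card (verts G) in
        1 \<le> n \<and> S n = G \<and> is_K1 (S 1) \<and>
        (\<forall>i \<in> {1..n}. d_trigraph d (S i)) \<and>
        (\<forall>i \<in> {2..n}. contraction (S i) (S (i - 1))))"

definition twin_width :: "'a trigraph \<Rightarrow> nat" where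
  "twin_width G = (LEAST d. \<exists>S. d_sequence d G S)"

definition modular_product :: "'a trigraph \<Rightarrow> 'b trigraph \<Rightarrow> ('a \<times> 'b) trigraph" where
  "modular_product G H =
     \<lparr> verts = verts G \<times> verts H,
       black = {{(u, i), (v, j)} | u i v j.
         u \<in> verts G \<and> v \<in> verts G \<and> i \<in> verts H \<and> j \<in> verts H \<and> u \<noteq> v \<and> i \<noteq> j \<and>
         ({u, v} \<in> black G \<and> {i, j} \<in> black H \<or> {u, v} \<notin> black G \<and> {i, j} \<notin> black H)},
       red = {} \<rparr>"

end

theory Submission imports Defs begin

text \<open>
  Edgeless \<open>G\<close> and \<open>H\<close> suffice: their twin-width and maximum degree vanish, but in the modular
  product of two edgeless graphs on \<open>n\<close> vertices (the complement of a rook's graph) any two vertices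
  are distinguished by at least \<open>n - 2\<close> others, so already the first contraction
  creates a vertex of red degree at least \<open>n - 2\<close>.
\<close>

text \<open>Every edge that avoids u and v stays inside \<open>verts G - {u, v}\<close>, which does
  not contain w, so old and new edges cannot interfere. This closure property is what lets
  \<open>trigraph\<close> serve as an invariant along contraction sequences.\<close>

lemma contract_trigraph:
  assumes G: "trigraph G" and uv: "u \<in> verts G" "v \<in> verts G" "u \<noteq> v"
    and w: "w \<notin> verts G - {u, v}"
  shows "trigraph (contract G u v w)"
proof -
  have loop: "{x} \<notin> black G \<union> red G" for x
    using G by (fastforce simp: trigraph_def)
  \<comment> \<open>\<open>contract\<close> excludes u and v explicitly only for the symmetric
    difference of the neighbourhoods; a common neighbour differs from both because there are no
    loops.\<close>
  have nbr: "x \<in> verts G" "x \<noteq> y" if "x \<in> nbrs G y" for x y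
    using that loop by (auto simp: nbrs_def)
  have wx: "x \<noteq> w \<and> x \<in> verts G - {u, v}"
    if "x \<in> nbrs G u \<union> nbrs G v" "x \<noteq> u" "x \<noteq> v" for x
    using that w nbr by auto
  have old: "e \<subseteq> verts G - {u, v} \<and> card e = 2 \<and> w \<notin> e"
    if "e \<in> black G \<union> red G" "u \<notin> e" "v \<notin> e" for e
    using that G w by (auto simp: trigraph_def)
  have "e \<subseteq> verts (contract G u v w) \<and> card e = 2"
    if "e \<in> black (contract G u v w) \<union> red (contract G u v w)" for e
  proof -
    from that consider "e \<in> black G \<union> red G" "u \<notin> e" "v \<notin> e"
      | x where "e = {w, x}" "x \<in> nbrs G u \<union> nbrs G v" "x \<noteq> u" "x \<noteq> v"
      using nbr by (auto simp: contract_def)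
    then show ?thesis
    proof cases
      case 1
      then show ?thesis using old by (auto simp: contract_def)
    next
      case 2
      then have "x \<noteq> w" "x \<in> verts G - {u, v}" using wx by blast+
      with 2 show ?thesis by (auto simp: contract_def)
    qed
  qed
  moreover have "black (contract G u v w) \<inter> red (contract G u v w) = {}"
  proof (intro equals0I)
    fix e
    assume "e \<in> black (contract G u v w) \<inter> red (contract G u v w)"
    then have b: "e \<in> black (contract G u v w)" and r: "e \<in> red (contract G u v w)" by auto
    show False
    \<comment> \<open>An edge at w is new and determines its other endpoint, so its colour is
      settled by that endpoint alone. An edge missing w is inherited with its old colour.\<close>
    proof (cases "w \<in> e")
      case True
      then have new: "\<not> (e \<in> black G \<union> red G \<and> u \<notin> e \<and> v \<notin> e)" using old by blast
      then obtain x where x: "e = {w, x}" "x \<in> nbrs G u \<inter> nbrs G v"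
          "{u, x} \<in> black G" "{v, x} \<in> black G"
        using b by (auto simp: contract_def)
      obtain y where y: "e = {w, y}"
          "y \<notin> nbrs G u \<inter> nbrs G v \<or> \<not> ({u, y} \<in> black G \<and> {v, y} \<in> black G)"
        using r new by (auto simp: contract_def)
      have "x = y" using x(1) y(1) by (auto simp: doubleton_eq_iff)
      then show False using x y by blast
    next
      case False
      then have "e \<in> black G \<inter> red G" using b r by (auto simp: contract_def)
      then show False using G by (auto simp: trigraph_def)
    qed
  qed
  moreover have "finite (verts (contract G u v w))"
    using G by (simp add: trigraph_def contract_def)
  ultimately show ?thesis
    unfolding trigraph_def by blast
qed

lemma card_verts_contract:
  assumes "finite (verts G)" "u \<in> verts G" "v \<in> verts G" "u \<noteq> v"
    and "w \<notin> verts G - {u, v}"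
  shows "card (verts (contract G u v w)) = card (verts G) - 1"
proof -
  have "card (verts G - {u, v}) = card (verts G) - 2"
    using assms by (simp add: card_Diff_subset)
  \<comment> \<open>This gives at least two vertices, so the truncated subtraction of 2 is exact
    before w is added back.\<close>
  moreover have "card {u, v} \<le> card (verts G)"
    using assms by (intro card_mono) auto
  ultimately show ?thesis
    using assms by (simp add: contract_def)
qed

text \<open>An invariant Q that survives every contraction and forces red degree at most d makes the
  order of contractions irrelevant: arbitrary pairs are merged until one vertex is left. The merged
  vertex keeps the name u, so no fresh element of the type is required.\<close>

lemma d_sequence_exists:
  assumes closed: "\<And>G u v. Q G \<Longrightarrow> u \<in> verts G \<Longrightarrow> v \<in> verts G \<Longrightarrow> u \<noteq> v \<Longrightarrow> Q (contract G u v u)"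
    and Qd: "\<And>G. Q G \<Longrightarrow> d_trigraph d G"
    and "Q G" "verts G \<noteq> {}"
  shows "\<exists>S. d_sequence d G S"
  using assms(3,4)
proof (induction "card (verts G)" arbitrary: G rule: less_induct)
  case less
  have d: "d_trigraph d G" and tri: "trigraph G" and fin: "finite (verts G)"
    using Qd[OF less.prems(1)] by (auto simp: d_trigraph_def trigraph_def)
  then have pos: "card (verts G) \<noteq> 0" using less.prems by simp
  show ?case
  proof (cases "card (verts G) = 1")
    case True
    then obtain x where x: "verts G = {x}" by (auto simp: card_1_singleton_iff)
    have False if "e \<in> black G \<union> red G" for e
    proof -
      have "e \<subseteq> {x}" "card e = 2" using tri that x by (auto simp: trigraph_def)
      then show False using card_mono[of "{x}" e] by simp
    qed
    then have "is_K1 G"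
      unfolding is_K1_def by (intro exI[of _ x] trigraph.equality) (use x in auto)
    then have "d_sequence d G (\<lambda>_. G)"
      using d True by (auto simp: d_sequence_def)
    then show ?thesis by blast
  next
    case False
    with pos have n2: "card (verts G) \<ge> 2" by simp
    then have "\<not> card (verts G) \<le> Suc 0" by simp
    then obtain u v where uv: "u \<in> verts G" "v \<in> verts G" "u \<noteq> v"
      unfolding card_le_Suc0_iff_eq[OF fin] by blast
    let ?G' = "contract G u v u"
    have card': "card (verts ?G') = card (verts G) - 1"
      using card_verts_contract[OF fin uv] by simp
    have "card (verts ?G') < card (verts G)" using card' n2 by simp
    moreover have "Q ?G'" using closed less.prems(1) uv by blast
    moreover have "verts ?G' \<noteq> {}" by (simp add: contract_def)
    ultimately obtain S where S: "d_sequence d ?G' S" using less.hyps by blast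
    have con: "contraction G ?G'" using uv by (auto simp: contraction_def)
    let ?n = "card (verts G)"
    have S1: "S (?n - 1) = ?G'" "is_K1 (S 1)"
      and Sd: "\<And>i. i \<in> {1..?n - 1} \<Longrightarrow> d_trigraph d (S i)"
      and Sc: "\<And>i. i \<in> {2..?n - 1} \<Longrightarrow> contraction (S i) (S (i - 1))"
      using S card' by (auto simp: d_sequence_def Let_def)
    \<comment> \<open>The sequence of the contracted trigraph occupies only the indices up to
      \<open>?n - 1\<close>, so overwriting index \<open>?n\<close> does not disturb it.\<close>
    let ?S = "S(?n := G)"
    have "d_trigraph d (?S i)" if "i \<in> {1..?n}" for i
      using that d Sd[of i] by (cases "i = ?n") auto
    moreover have "contraction (?S i) (?S (i - 1))" if "i \<in> {2..?n}" for i
    proof (cases "i = ?n")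
      case True
      moreover have "?n - 1 \<noteq> ?n" using n2 by linarith
      ultimately show ?thesis using con S1 by simp
    next
      case False
      then have "i \<in> {2..?n - 1}" "i - 1 \<noteq> ?n" using that by auto
      then show ?thesis using False Sc[of i] by simp
    qed
    ultimately have "d_sequence d G ?S"
      using S1 n2 by (simp add: d_sequence_def)
    then show ?thesis by blast
  qed
qed

text \<open>\<open>LEAST\<close> says something only once some d is known to admit a sequence, so a
  crude bound on the red degree is supplied.\<close>

lemma twin_width_attained:
  assumes "trigraph G" "verts G \<noteq> {}"
  shows "\<exists>S. d_sequence (twin_width G) G S"
proof -
  let ?N = "card (verts G)"
  have "\<exists>S. d_sequence (2 ^ ?N) G S"
  \<comment> \<open>Edges are sets of vertices, so at most 2 to the number of vertices of them are
    red. The cardinality clause keeps this bound uniform while the trigraph shrinks.\<close>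
  proof (rule d_sequence_exists[where Q = "\<lambda>G. trigraph G \<and> card (verts G) \<le> ?N"])
    fix G' :: "'a trigraph" and u v
    assume "trigraph G' \<and> card (verts G') \<le> ?N" "u \<in> verts G'" "v \<in> verts G'" "u \<noteq> v"
    then show "trigraph (contract G' u v u) \<and> card (verts (contract G' u v u)) \<le> ?N"
      using contract_trigraph[of G' u v u] card_verts_contract[of G' u v u]
      by (auto simp: trigraph_def[of G'])
  next
    fix G' :: "'a trigraph"
    assume G': "trigraph G' \<and> card (verts G') \<le> ?N"
    have "card {e \<in> red G'. x \<in> e} \<le> 2 ^ ?N" for x
    proof -
      have "card {e \<in> red G'. x \<in> e} \<le> card (Pow (verts G'))"
        using G' by (intro card_mono) (auto simp: trigraph_def)
      also have "\<dots> = 2 ^ card (verts G')"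
        using G' by (simp add: card_Pow trigraph_def)
      also have "\<dots> \<le> 2 ^ ?N" using G' by simp
      finally show ?thesis .
    qed
    then show "d_trigraph (2 ^ ?N) G'" using G' by (simp add: d_trigraph_def)
  qed (use assms in auto)
  then show ?thesis
    unfolding twin_width_def by (rule LeastI)
qed

text \<open>The first contraction of an optimal sequence merges some u and v into w, and each vertex
  that tells u and v apart becomes the other end of its own red edge at w.\<close>

lemma le_twin_width:
  assumes G: "trigraph G" and n2: "card (verts G) \<ge> 2"
    and diff: "\<And>u v. u \<in> verts G \<Longrightarrow> v \<in> verts G \<Longrightarrow> u \<noteq> v \<Longrightarrow>
      k \<le> card (((nbrs G u - nbrs G v) \<union> (nbrs G v - nbrs G u)) - {u, v})"
  shows "k \<le> twin_width G"
proof -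
  let ?n = "card (verts G)"
  from n2 have "verts G \<noteq> {}" by auto
  then obtain S where S: "d_sequence (twin_width G) G S"
    using twin_width_attained[OF G] by blast
  have "contraction (S ?n) (S (?n - 1))" "S ?n = G" "d_trigraph (twin_width G) (S (?n - 1))"
    using S n2 unfolding d_sequence_def Let_def by (metis atLeastAtMost_iff order_refl, auto)
  then obtain u v w where uv: "u \<in> verts G" "v \<in> verts G" "u \<noteq> v" and w: "w \<notin> verts G - {u, v}"
    and d: "d_trigraph (twin_width G) (contract G u v w)"
    unfolding contraction_def by metis
  let ?D = "((nbrs G u - nbrs G v) \<union> (nbrs G v - nbrs G u)) - {u, v}"
  let ?R = "{e \<in> red (contract G u v w). w \<in> e}"
  have "finite (verts (contract G u v w))"
    "red (contract G u v w) \<subseteq> Pow (verts (contract G u v w))"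
    using d by (auto simp: d_trigraph_def trigraph_def)
  then have "finite ?R"
    using finite_subset[of ?R "Pow (verts (contract G u v w))"] by blast
  moreover have "inj_on (\<lambda>x. {w, x}) ?D" by (auto simp: inj_on_def doubleton_eq_iff)
  moreover have "(\<lambda>x. {w, x}) ` ?D \<subseteq> ?R" by (auto simp: contract_def)
  ultimately have "card ?D \<le> card ?R" by (intro card_inj_on_le)
  also have "\<dots> \<le> twin_width G" using d by (simp add: d_trigraph_def contract_def)
  finally show ?thesis using diff[OF uv] by simp
qed

definition edgeless :: "nat \<Rightarrow> nat trigraph" where
  "edgeless n = \<lparr> verts = {..<n}, black = {}, red = {} \<rparr>"

lemma edgeless_graph: "n > 0 \<Longrightarrow> graph (edgeless n)"
  by (auto simp: graph_def trigraph_def edgeless_def)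

lemma max_degree_edgeless: "n > 0 \<Longrightarrow> max_degree (edgeless n) = 0"
  by (simp add: max_degree_def nbrs_def edgeless_def lessThan_empty_iff)

lemma twin_width_edgeless:
  assumes "n > 0"
  shows "twin_width (edgeless n) = 0"
proof -
  have "\<exists>S. d_sequence 0 (edgeless n) S"
    \<comment> \<open>Contracting in a trigraph without edges creates none, so the red degree stays
      0 throughout.\<close>
    by (rule d_sequence_exists
        [where Q = "\<lambda>G. finite (verts G) \<and> black G = {} \<and> red G = {}"])
      (use assms in \<open>auto simp: edgeless_def contract_def nbrs_def d_trigraph_def trigraph_def\<close>)
  then show ?thesis by (simp add: twin_width_def)
qed

lemma nbrs_modular_product_edgeless:
  assumes "a < m" "i < n"
  shows "nbrs (modular_product (edgeless m) (edgeless n)) (a, i) = ({..<m} - {a}) \<times> ({..<n} - {i})"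
  using assms by (auto simp: nbrs_def modular_product_def edgeless_def doubleton_eq_iff)

lemma trigraph_modular_product:
  assumes "finite (verts G)" "finite (verts H)"
  shows "trigraph (modular_product G H)"
  using assms by (auto simp: trigraph_def modular_product_def)

lemma twin_width_modular_product_edgeless:
  assumes "n \<ge> 2"
  shows "n - 2 \<le> twin_width (modular_product (edgeless n) (edgeless n))" (is "_ \<le> twin_width ?P")
proof (rule le_twin_width)
  show "trigraph ?P" by (rule trigraph_modular_product) (simp_all add: edgeless_def)
  have verts: "verts ?P = {..<n} \<times> {..<n}" by (simp add: modular_product_def edgeless_def)
  show "2 \<le> card (verts ?P)"
    using assms mult_le_mono[of 2 n 1 n] by (simp add: verts card_cartesian_product)
  fix p q
  assume pq: "p \<in> verts ?P" "q \<in> verts ?P" "p \<noteq> q"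
  let ?D = "((nbrs ?P p - nbrs ?P q) \<union> (nbrs ?P q - nbrs ?P p)) - {p, q}"
  obtain a i b j where p: "p = (a, i)" and q: "q = (b, j)" by (metis surj_pair)
  have lt: "a < n" "b < n" "i < n" "j < n" using pq by (auto simp: p q verts)
  have D: "?D = ((({..<n} - {a}) \<times> ({..<n} - {i}) - ({..<n} - {b}) \<times> ({..<n} - {j})) \<union>
      (({..<n} - {b}) \<times> ({..<n} - {j}) - ({..<n} - {a}) \<times> ({..<n} - {i}))) - {p, q}"
    using lt by (simp add: p q nbrs_modular_product_edgeless)
  then have fin: "finite ?D" by simp
  have minus2: "n - 2 \<le> card ({..<n} - {x, y})" for x y
    using diff_card_le_card_Diff[of "{x, y}" "{..<n}"] card_insert_le_m1[of 2 "{y}" x] by simp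
  show "n - 2 \<le> card ?D"
  proof (cases "a = b")
    case True
    \<comment> \<open>Here i and j differ. A vertex (c, j) with c different from a is adjacent to p,
      but not to q, with which it shares the second coordinate.\<close>
    then have "({..<n} - {a, b}) \<times> {j} \<subseteq> ?D"
      unfolding D using lt pq by (auto simp: p q)
    then have "card (({..<n} - {a, b}) \<times> {j}) \<le> card ?D" by (rule card_mono[OF fin])
    then show ?thesis using minus2[of a b] by (simp add: card_cartesian_product)
  next
    case False
    \<comment> \<open>A vertex (b, c) with c outside {i, j} differs from p in both coordinates,
      hence is adjacent to it, but shares its first coordinate with q.\<close>
    then have "{b} \<times> ({..<n} - {i, j}) \<subseteq> ?D"
      unfolding D using lt by (auto simp: p q)
    then have "card ({b} \<times> ({..<n} - {i, j})) \<le> card ?D" by (rule card_mono[OF fin])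
    then show ?thesis using minus2[of i j] by (simp add: card_cartesian_product)
  qed
qed

theorem corollary3p13:
  "\<not> (\<exists>f :: nat \<Rightarrow> nat \<Rightarrow> nat \<Rightarrow> nat \<Rightarrow> nat.
        \<forall>(G :: nat trigraph) (H :: nat trigraph). graph G \<longrightarrow> graph H \<longrightarrow>
          twin_width (modular_product G H)
            \<le> f (twin_width G) (twin_width H) (max_degree G) (max_degree H))"
proof
  assume "\<exists>f :: nat \<Rightarrow> nat \<Rightarrow> nat \<Rightarrow> nat \<Rightarrow> nat.
        \<forall>(G :: nat trigraph) (H :: nat trigraph). graph G \<longrightarrow> graph H \<longrightarrow>
          twin_width (modular_product G H)
            \<le> f (twin_width G) (twin_width H) (max_degree G) (max_degree H)"
  then obtain f :: "nat \<Rightarrow> nat \<Rightarrow> nat \<Rightarrow> nat \<Rightarrow> nat" where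
    f: "\<forall>(G :: nat trigraph) (H :: nat trigraph). graph G \<longrightarrow> graph H \<longrightarrow>
          twin_width (modular_product G H)
            \<le> f (twin_width G) (twin_width H) (max_degree G) (max_degree H)"
    by (elim exE)
  \<comment> \<open>With this size the lower bound \<open>n - 2\<close> equals
    \<open>f 0 0 0 0 + 1\<close>, just above the assumed upper bound.\<close>
  let ?E = "edgeless (f 0 0 0 0 + 3)"
  have "twin_width (modular_product ?E ?E) \<le> f 0 0 0 0"
    using f[rule_format, of ?E ?E] by (simp add: edgeless_graph twin_width_edgeless max_degree_edgeless)
  then show False
    using twin_width_modular_product_edgeless[of "f 0 0 0 0 + 3"] by simp
qed

end
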